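(* Let $G$ be a countable (discrete) abelian group and let $E\subseteq G$ be an $I_0$ set. If $S\subseteq E-E$ and $S$ is a set of Bohr recurrence in $G$, then $S$ is a set of chromatic recurrence in $G$.
   Context: All groups are discrete. $\mathcal S^1=\{z\in\mathbb C:|z|=1\}$ under multiplication, and $\mathbb T=\mathbb R/\mathbb Z$. For $\mathbf x=(x_1,\dots,x_d)\in\mathbb T^d$, $\|\mathbf x\|:=\max_{j\le d}\min_{n\in\mathbb Z}|x_j-n|$. A character of $G$ is a homomorphism $G\to\mathcal S^1$. A trigonometric polynomial on $G$ is a (finite) complex linear combination of characters of $G$. A function $\psi:G\to\mathbb C$ is almost periodic if it is a uniform limit of trigonometric polynomials. $E-E:=\{a-a':a,a'\in E\}$. $E\subseteq G$ is an $I_0$ set if for every bounded $f:E\to\mathbb C$ there is an almost periodic $\psi:G\to\mathbb C$ such that $\psi|_E=f$. $S\subseteq G$ is a set of Bohr recurrence if for every $d\in\mathbb N$, every homomorphism $\rho:G\to\mathbb T^d$, and every $\varepsilon>0$, there exists $s\in S$ with $\|\rho(s)\|<\varepsilon$. $S\subseteq G$ is a set of chromatic recurrence if for every $r\in\mathbb N$ and every $f:G\to\{1,\dots,r\}$ there exist $a,b\in G$ such that $f(a)=f(b)$ and $b-a\in S$. *)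

theory Defs
  imports "HOL-Analysis.Analysis" "HOL-Library.Countable"
begin

section \<open>Characters, almost periodic functions and \<open>I\<^sub>0\<close> sets\<close>

definition character :: "('a::ab_group_add \<Rightarrow> complex) \<Rightarrow> bool" where
  "character \<gamma> \<longleftrightarrow> range \<gamma> \<subseteq> sphere 0 1 \<and> (\<forall>x y. \<gamma> (x + y) = \<gamma> x * \<gamma> y)"

definition trig_polynomial :: "('a::ab_group_add \<Rightarrow> complex) \<Rightarrow> bool" where
  "trig_polynomial p \<longleftrightarrow>
     (\<exists>X c. finite X \<and> (\<forall>\<gamma>\<in>X. character \<gamma>) \<and> p = (\<lambda>x. \<Sum>\<gamma>\<in>X. c \<gamma> * \<gamma> x))"

definition almost_periodic :: "('a::ab_group_add \<Rightarrow> complex) \<Rightarrow> bool" where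
  "almost_periodic \<psi> \<longleftrightarrow>
     (\<exists>p. (\<forall>n. trig_polynomial (p n)) \<and> uniform_limit UNIV p \<psi> sequentially)"

text \<open>A function on \<open>E\<close> is represented by a total function of which only the values on \<open>E\<close> matter.\<close>

definition I0_set :: "'a::ab_group_add set \<Rightarrow> bool" where
  "I0_set E \<longleftrightarrow>
     (\<forall>f :: 'a \<Rightarrow> complex. bounded (f ` E) \<longrightarrow>
        (\<exists>\<psi>. almost_periodic \<psi> \<and> (\<forall>x\<in>E. \<psi> x = f x)))"

section \<open>The torus\<close>

quotient_type circle = real / "\<lambda>x y :: real. x - y \<in> \<int>"
proof (rule equivpI)
  show "reflp (\<lambda>x y :: real. x - y \<in> \<int>)"
    by (simp add: reflp_def)
  show "symp (\<lambda>x y :: real. x - y \<in> \<int>)"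
    unfolding symp_def by (metis Ints_minus minus_diff_eq)
  show "transp (\<lambda>x y :: real. x - y \<in> \<int>)"
    unfolding transp_def by (metis Ints_add add_diff_eq diff_add_cancel)
qed

instantiation circle :: ab_group_add
begin

lift_definition zero_circle :: circle is "0 :: real" .

lift_definition plus_circle :: "circle \<Rightarrow> circle \<Rightarrow> circle" is "(+) :: real \<Rightarrow> real \<Rightarrow> real"
  by (metis Ints_add add_diff_add)

lift_definition uminus_circle :: "circle \<Rightarrow> circle" is "uminus :: real \<Rightarrow> real"
  by (metis Ints_minus minus_diff_minus)

lift_definition minus_circle :: "circle \<Rightarrow> circle \<Rightarrow> circle" is "(-) :: real \<Rightarrow> real \<Rightarrow> real"
  by (metis Ints_diff diff_diff_eq diff_diff_eq2 add.commute add_diff_eq)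

instance
  by standard (transfer; simp)+

end

text \<open>The infimum over the integers is a minimum, see \<open>circle_norm_attained\<close>.\<close>

lift_definition circle_norm :: "circle \<Rightarrow> real" is
  "\<lambda>x :: real. INF n :: int. \<bar>x - of_int n\<bar>"
proof -
  fix x y :: real
  assume "x - y \<in> \<int>"
  then obtain k :: int where k: "x = y + of_int k"
    by (metis Ints_cases add.commute diff_add_cancel)
  have "range (\<lambda>n :: int. \<bar>x - of_int n\<bar>) = range (\<lambda>n :: int. \<bar>y - of_int n\<bar>)"
  proof (intro equalityI subsetI)
    fix z assume "z \<in> range (\<lambda>n :: int. \<bar>x - of_int n\<bar>)"
    then obtain n :: int where "z = \<bar>x - of_int n\<bar>" by auto
    then have "z = \<bar>y - of_int (n - k)\<bar>" using k by (simp add: algebra_simps)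
    then show "z \<in> range (\<lambda>n :: int. \<bar>y - of_int n\<bar>)" by blast
  next
    fix z assume "z \<in> range (\<lambda>n :: int. \<bar>y - of_int n\<bar>)"
    then obtain n :: int where "z = \<bar>y - of_int n\<bar>" by auto
    then have "z = \<bar>x - of_int (n + k)\<bar>" using k by (simp add: algebra_simps)
    then show "z \<in> range (\<lambda>n :: int. \<bar>x - of_int n\<bar>)" by blast
  qed
  then show "(INF n :: int. \<bar>x - of_int n\<bar>) = (INF n :: int. \<bar>y - of_int n\<bar>)"
    by simp
qed

lemma circle_norm_attained:
  "\<exists>n :: int. circle_norm (abs_circle x) = \<bar>x - of_int n\<bar> \<and>
     (\<forall>m :: int. \<bar>x - of_int n\<bar> \<le> \<bar>x - of_int m\<bar>)"
proof -
  have least: "\<forall>m :: int. \<bar>x - of_int (round x)\<bar> \<le> \<bar>x - of_int m\<bar>"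
    by (metis abs_minus_commute round_diff_minimal)
  have "(INF n :: int. \<bar>x - of_int n\<bar>) = \<bar>x - of_int (round x)\<bar>"
    by (rule cInf_eq_minimum) (use least in auto)
  then show ?thesis
    using least by (auto simp: circle_norm.abs_eq)
qed

text \<open>
  Points of the \<open>d\<close>-dimensional torus are functions on \<open>{..<d}\<close>, with the default value
  \<open>undefined\<close> elsewhere; its group operation is pointwise on \<open>{..<d}\<close>.
\<close>

definition torus :: "nat \<Rightarrow> (nat \<Rightarrow> circle) set" where
  "torus d = {..<d} \<rightarrow>\<^sub>E UNIV"

text \<open>Only meaningful for \<open>d \<ge> 1\<close>, since the maximum is over an empty set if \<open>d = 0\<close>.\<close>

definition torus_norm :: "nat \<Rightarrow> (nat \<Rightarrow> circle) \<Rightarrow> real" where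
  "torus_norm d x = Max ((\<lambda>j. circle_norm (x j)) ` {..<d})"

definition torus_hom :: "nat \<Rightarrow> ('a::ab_group_add \<Rightarrow> nat \<Rightarrow> circle) \<Rightarrow> bool" where
  "torus_hom d \<rho> \<longleftrightarrow>
     range \<rho> \<subseteq> torus d \<and> (\<forall>x y. \<forall>j<d. \<rho> (x + y) j = \<rho> x j + \<rho> y j)"

section \<open>Recurrence\<close>

definition bohr_recurrence :: "'a::ab_group_add set \<Rightarrow> bool" where
  "bohr_recurrence S \<longleftrightarrow>
     (\<forall>d \<ge> 1. \<forall>\<rho>. torus_hom d \<rho> \<longrightarrow> (\<forall>\<epsilon> > 0. \<exists>s\<in>S. torus_norm d (\<rho> s) < \<epsilon>))"

definition chromatic_recurrence :: "'a::ab_group_add set \<Rightarrow> bool" where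
  "chromatic_recurrence S \<longleftrightarrow>
     (\<forall>r. \<forall>f :: 'a \<Rightarrow> nat. range f \<subseteq> {1..r} \<longrightarrow> (\<exists>a b. f a = f b \<and> b - a \<in> S))"

definition difference_set :: "'a::ab_group_add set \<Rightarrow> 'a set" where
  "difference_set E = {a - a' | a a'. a \<in> E \<and> a' \<in> E}"

end

theory Submission imports Defs begin

text \<open>
  Restrict a finite colouring of \<open>G\<close> to \<open>E\<close> and extend it to an almost periodic function, which is
  uniformly close to a trigonometric polynomial \<open>p\<close>. Since \<open>\<bar>\<gamma> a - \<gamma> a'\<bar> = \<bar>\<gamma> (a - a') - 1\<bar>\<close> for a
  character \<open>\<gamma>\<close>, the values \<open>p a\<close> and \<open>p a'\<close> are close as soon as the finitely many characters in \<open>p\<close>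
  are close to \<open>1\<close> at \<open>a - a'\<close>, which Bohr recurrence provides for some \<open>a - a' \<in> S\<close> with
  \<open>a, a' \<in> E\<close>. The colours of \<open>a\<close> and \<open>a'\<close> are then integers at distance less than \<open>1\<close>.
\<close>

lemma character_add: "character \<gamma> \<Longrightarrow> \<gamma> (x + y) = \<gamma> x * \<gamma> y"
  by (simp add: character_def)

lemma norm_character [simp]: "character \<gamma> \<Longrightarrow> cmod (\<gamma> x) = 1"
  by (auto simp: character_def image_subset_iff)

lemma norm_character_diff:
  assumes "character \<gamma>"
  shows "cmod (\<gamma> x - \<gamma> y) = cmod (\<gamma> (x - y) - 1)"
proof -
  have "\<gamma> x - \<gamma> y = (\<gamma> (x - y) - 1) * \<gamma> y"
    using character_add[OF assms, of "x - y" y] by (simp add: algebra_simps)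
  then show ?thesis
    using assms by (simp add: norm_mult)
qed

text \<open>On the unit circle this inverts the isomorphism t -> exp(2 pi i t) from R/Z; the
  quotient absorbs the jump of \<open>Arg\<close>.\<close>

definition unit_circle_angle :: "complex \<Rightarrow> circle" where
  "unit_circle_angle z = abs_circle (Arg z / (2 * pi))"

lemma unit_circle_angle_mult:
  assumes "z \<noteq> 0" "w \<noteq> 0"
  shows "unit_circle_angle (z * w) = unit_circle_angle z + unit_circle_angle w"
proof -
  \<comment> \<open>The number of full turns that brings the sum of the arguments back into (-pi,
    pi].\<close>
  define k :: int where
    "k = (if Arg z + Arg w \<in> {-pi<..pi} then 0 else if Arg z + Arg w > pi then -1 else 1)"
  have "Arg (z * w) = Arg z + Arg w + 2 * pi * of_int k"
    unfolding Arg_times'[OF assms] k_def by simp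
  then have "Arg (z * w) / (2 * pi) - (Arg z / (2 * pi) + Arg w / (2 * pi)) = of_int k"
    by (simp add: field_simps)
  then show ?thesis
    unfolding unit_circle_angle_def plus_circle.abs_eq circle.abs_eq_iff by simp
qed

text \<open>A chord is no longer than its arc: the shorter arc from 1 to z has length 2 pi times the
  distance from the angle to the nearest integer.\<close>

lemma norm_minus_1_le_circle_norm:
  assumes "cmod z = 1"
  shows "cmod (z - 1) \<le> 2 * pi * circle_norm (unit_circle_angle z)"
proof -
  define t where "t = Arg z / (2 * pi)"
  obtain n :: int where n: "circle_norm (abs_circle t) = \<bar>t - of_int n\<bar>"
    using circle_norm_attained by blast
  have "z = exp (\<i> * of_real (Arg z))"
    using Arg_eq[of z] assms by fastforce
  also have "\<dots> = exp (\<i> * of_real (2 * pi * (t - of_int n)))"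
    by (rule iffD2[OF exp_eq], rule exI[of _ n]) (simp add: t_def algebra_simps)
  finally have z: "z = exp (\<i> * of_real (2 * pi * (t - of_int n)))" .
  have "cmod (z - 1) \<le> \<bar>2 * pi * (t - of_int n)\<bar>"
    unfolding z dist_exp_i_1
    using abs_sin_x_le_abs_x[of "2 * pi * (t - of_int n) / 2"] by simp
  then show ?thesis
    using n by (simp add: unit_circle_angle_def t_def abs_mult)
qed

text \<open>The angles of finitely many characters are the coordinates of a single homomorphism into
  a torus.\<close>

lemma bohr_recurrence_characters:
  assumes "bohr_recurrence S" "finite X" "\<And>\<gamma>. \<gamma> \<in> X \<Longrightarrow> character \<gamma>" "\<epsilon> > 0"
  shows "\<exists>s\<in>S. \<forall>\<gamma>\<in>X. cmod (\<gamma> s - 1) < \<epsilon>"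
proof -
  \<comment> \<open>Adding the trivial character makes the dimension of the torus positive.\<close>
  define Y where "Y = insert (\<lambda>_. 1) X"
  have Y: "finite Y" "Y \<noteq> {}" and char: "\<And>\<gamma>. \<gamma> \<in> Y \<Longrightarrow> character \<gamma>"
    using assms by (auto simp: Y_def character_def)
  define d where "d = card Y"
  obtain g where g: "bij_betw g {..<d} Y"
    using ex_bij_betw_nat_finite[OF Y(1)] by (auto simp: d_def atLeast0LessThan)
  then have gY: "character (g j)" if "j < d" for j
    using that char by (auto simp: bij_betw_def)
  define \<rho> where "\<rho> x = restrict (\<lambda>j. unit_circle_angle (g j x)) {..<d}" for x
  have "g j x \<noteq> 0" if "j < d" for j x
    using norm_character[OF gY[OF that], of x] by auto
  then have "torus_hom d \<rho>"
    by (auto simp: torus_hom_def torus_def \<rho>_def character_add gY unit_circle_angle_mult split: if_splits)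
  moreover have "d \<ge> 1"
    using Y by (simp add: d_def Suc_le_eq card_gt_0_iff)
  ultimately obtain s where s: "s \<in> S" "torus_norm d (\<rho> s) < \<epsilon> / (2 * pi)"
    using assms(1,4) unfolding bohr_recurrence_def
    by (metis divide_pos_pos mult_pos_pos pi_gt_zero zero_less_numeral)
  have "cmod (\<gamma> s - 1) < \<epsilon>" if "\<gamma> \<in> X" for \<gamma>
  proof -
    have "\<gamma> \<in> Y"
      using that by (simp add: Y_def)
    then obtain j where j: "j < d" "\<gamma> = g j"
      using g by (auto simp: bij_betw_def)
    have "circle_norm (\<rho> s j) \<le> torus_norm d (\<rho> s)"
      unfolding torus_norm_def using j by (intro Max_ge) auto
    then have "circle_norm (unit_circle_angle (\<gamma> s)) < \<epsilon> / (2 * pi)"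
      using s(2) j by (simp add: \<rho>_def)
    then have "2 * pi * circle_norm (unit_circle_angle (\<gamma> s)) < \<epsilon>"
      by (simp add: field_simps)
    then show ?thesis
      using norm_minus_1_le_circle_norm[of "\<gamma> s"] norm_character[OF assms(3)[OF that]] by force
  qed
  then show ?thesis
    using s(1) by blast
qed

lemma bohr_recurrence_trig_polynomial:
  assumes "bohr_recurrence S" "trig_polynomial p" "\<epsilon> > 0"
  shows "\<exists>s\<in>S. \<forall>x y. x - y = s \<longrightarrow> cmod (p x - p y) < \<epsilon>"
proof -
  obtain X c where X: "finite X" "\<And>\<gamma>. \<gamma> \<in> X \<Longrightarrow> character \<gamma>"
    and p: "p = (\<lambda>x. \<Sum>\<gamma>\<in>X. c \<gamma> * \<gamma> x)"
    using assms(2) unfolding trig_polynomial_def by blast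
  \<comment> \<open>The added 1 keeps C positive when all coefficients vanish and makes the final
    estimate strict, as C - 1 < C.\<close>
  define C where "C = (\<Sum>\<gamma>\<in>X. cmod (c \<gamma>)) + 1"
  have "C > 0"
    unfolding C_def by (intro add_nonneg_pos sum_nonneg) auto
  then obtain s where s: "s \<in> S" "\<And>\<gamma>. \<gamma> \<in> X \<Longrightarrow> cmod (\<gamma> s - 1) < \<epsilon> / C"
    using bohr_recurrence_characters[OF assms(1) X, of "\<epsilon> / C"] assms(3) by auto
  have "cmod (p x - p y) < \<epsilon>" if "x - y = s" for x y
  proof -
    have "p x - p y = (\<Sum>\<gamma>\<in>X. c \<gamma> * (\<gamma> x - \<gamma> y))"
      by (simp add: p sum_subtractf right_diff_distrib)
    also have "cmod \<dots> \<le> (\<Sum>\<gamma>\<in>X. cmod (c \<gamma>) * (\<epsilon> / C))"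
      by (rule sum_norm_le)
        (use that s(2) X(2) in \<open>simp add: norm_mult norm_character_diff mult_left_mono less_imp_le
          del: times_divide_eq_right\<close>)
    also have "\<dots> = (C - 1) * (\<epsilon> / C)"
      unfolding sum_distrib_right[symmetric] by (simp add: C_def)
    also have "\<dots> < \<epsilon>"
      using \<open>C > 0\<close> assms(3) by (simp add: field_simps)
    finally show ?thesis .
  qed
  then show ?thesis
    using s(1) by blast
qed

theorem proposition2p3:
  fixes E S :: "'a::{ab_group_add, countable} set"
  assumes "I0_set E"
    and "S \<subseteq> difference_set E"
    and "bohr_recurrence S"
  shows "chromatic_recurrence S"
  unfolding chromatic_recurrence_def
proof (intro allI impI)
  fix r :: nat and f :: "'a \<Rightarrow> nat"
  assume "range f \<subseteq> {1..r}"
  then have "bounded ((\<lambda>x. of_nat (f x) :: complex) ` E)"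
    by (auto simp: bounded_iff image_subset_iff intro!: exI[of _ "real r"])
  then obtain \<psi> :: "'a \<Rightarrow> complex"
    where "almost_periodic \<psi>" and \<psi>f: "\<And>x. x \<in> E \<Longrightarrow> \<psi> x = of_nat (f x)"
    using assms(1) unfolding I0_set_def by blast
  then obtain q where q: "\<And>n. trig_polynomial (q n)" "uniform_limit UNIV q \<psi> sequentially"
    unfolding almost_periodic_def by blast
  \<comment> \<open>Three errors below 1/3 will add up to less than 1: from \<psi> to
    \<open>q n\<close> at a, from a to a' within \<open>q n\<close>, and back to \<psi> at
    a'.\<close>
  have "\<forall>\<^sub>F n in sequentially. \<forall>x\<in>UNIV. dist (q n x) (\<psi> x) < 1/3"
    by (rule uniform_limitD[OF q(2)]) simp
  then obtain n where n: "\<And>x. dist (q n x) (\<psi> x) < 1/3"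
    using eventually_happens'[OF sequentially_bot] by blast
  obtain s where "s \<in> S" and s: "\<And>x y. x - y = s \<Longrightarrow> cmod (q n x - q n y) < 1/3"
    using bohr_recurrence_trig_polynomial[OF assms(3) q(1)[of n], of "1/3"] by auto
  obtain a a' where a: "a \<in> E" "a' \<in> E" "s = a - a'"
    using assms(2) \<open>s \<in> S\<close> by (auto simp: difference_set_def)
  have "dist (\<psi> a) (\<psi> a') < 1"
    using n[of a] n[of a'] s[of a a'] a(3)
      dist_triangle[of "\<psi> a" "\<psi> a'" "q n a"] dist_triangle[of "q n a" "\<psi> a'" "q n a'"]
    by (simp add: dist_commute flip: dist_norm)
  then have "dist (f a) (f a') < 1"
    using a \<psi>f by (simp add: dist_of_nat)
  then have "f a' = f a"
    by (simp add: dist_real_def)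
  \<comment> \<open>The witnesses are swapped: a' serves as the bound a and a as b, so that the
    difference is s.\<close>
  then show "\<exists>a b. f a = f b \<and> b - a \<in> S"
    using \<open>s \<in> S\<close> a(3) by blast
qed

end
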